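(* Let $(X,p,E)$ be a lattice-normed Riesz space, let $e$ be a $p$-unit in $X$, and let $(x_n)$ be a sequence in $X$. Then $(x_n)$ is statistically unbounded $p$-convergent to $0$ in $X$ if and only if the sequence $\big(p(|x_n|\wedge e)\big)$ is statistically order convergent to $0$ in $E$.
   Context: All Riesz spaces (vector lattices) are real and Archimedean; sequences are indexed by the positive integers $\mathbb{N}$; $E_+$ and $X_+$ denote positive cones. A sequence $(a_n)$ in a Riesz space $E$ is order convergent to $a\in E$, written $a_n\xrightarrow{o}a$, if there is a sequence $(q_n)$ in $E$, decreasing with infimum $0$, such that $|a_n-a|\le q_n$ for all $n$. A lattice-normed Riesz space $(X,p,E)$ consists of Riesz spaces $X$ and $E$ and a map $p:X\to E_+$ with $p(x)=0\Leftrightarrow x=0$, $p(\lambda x)=|\lambda|p(x)$ for $\lambda\in\mathbb{R}$, $p(x+y)\le p(x)+p(y)$, which is monotone: $|x|\le|y|$ implies $p(x)\le p(y)$. A vector $e\in X$ is a $p$-unit if $p\big(x-(ne)\wedge x\big)\xrightarrow{o}0$ in $E$ as $n\to\infty$, for every $x\in X_+$. The natural density of $K\subseteq\mathbb{N}$ is $\delta(K)=\lim_{n}\frac1n|\{k\le n:k\in K\}|$. A sequence $(q_n)$ in $E$ is statistically order decreasing to $0$, written $q_n\downarrow^{st}0$, if there is $K\subseteq\mathbb{N}$ with $\delta(K)=1$ such that $(q_k)_{k\in K}$ is decreasing and $\inf_{k\in K}q_k=0$. A sequence $(a_n)$ in $E$ is statistically order convergent to $a\in E$ if there exist $q_n\downarrow^{st}0$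 in $E$ and $K\subseteq\mathbb{N}$ with $\delta(K)=1$ such that $|a_k-a|\le q_k$ for all $k\in K$. A sequence $(x_n)$ in $X$ is statistically unbounded $p$-convergent ($st$-$up$-convergent) to $x\in X$ if for every $u\in X_+$ there exist a sequence $q_n\downarrow^{st}0$ in $E$ and a set $K\subseteq\mathbb{N}$ with $\delta(K)=1$ such that $p(|x_k-x|\wedge u)\le q_k$ for all $k\in K$. *)

theory Defs
  imports Complex_Main "HOL-Library.Lattice_Algebras"
begin

text \<open>
  Sequences are indexed by the positive integers: they are represented by functions on
  \<^typ>\<open>nat\<close> whose value at \<open>0\<close> is never looked at, and index sets are subsets of \<open>{1..}\<close>.
\<close>

text \<open>The axiom \<open>\<bar>a\<bar> = sup a (- a)\<close> comes with \<^class>\<open>lattice_ab_group_add_abs\<close>.\<close>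

class archimedean_riesz_space = ordered_real_vector + lattice_ab_group_add_abs +
  assumes archimedean: "(\<And>n::nat. n \<ge> 1 \<Longrightarrow> real n *\<^sub>R x \<le> y) \<Longrightarrow> x \<le> 0"

instance real :: archimedean_riesz_space
proof
  fix x y :: real
  assume *: "\<And>n::nat. n \<ge> 1 \<Longrightarrow> real n *\<^sub>R x \<le> y"
  show "x \<le> 0"
  proof (rule ccontr)
    assume "\<not> x \<le> 0"
    then have "0 < x" by simp
    from reals_Archimedean3[OF this] obtain n :: nat where n: "y < real n * x" by blast
    have "real n * x \<le> real (Suc n) * x"
      using \<open>0 < x\<close> by (intro mult_right_mono) auto
    with n *[of "Suc n"] show False by simp
  qed
qed

locale lattice_normed_riesz_space =
  fixes p :: "'x::archimedean_riesz_space \<Rightarrow> 'e::archimedean_riesz_space"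
  assumes p_nonneg: "0 \<le> p x"
    and p_eq_0_iff: "p x = 0 \<longleftrightarrow> x = 0"
    and p_scaleR: "p (c *\<^sub>R x) = \<bar>c\<bar> *\<^sub>R p x"
    and p_triangle: "p (x + y) \<le> p x + p y"
    and p_mono: "\<bar>x\<bar> \<le> \<bar>y\<bar> \<Longrightarrow> p x \<le> p y"

text \<open>
  Infima need not exist in a Riesz space, so they are expressed relationally.
\<close>

definition is_infimum :: "'a::order set \<Rightarrow> 'a \<Rightarrow> bool" where
  "is_infimum S a \<longleftrightarrow> (\<forall>s\<in>S. a \<le> s) \<and> (\<forall>b. (\<forall>s\<in>S. b \<le> s) \<longrightarrow> b \<le> a)"

definition order_convergent :: "(nat \<Rightarrow> 'e::archimedean_riesz_space) \<Rightarrow> 'e \<Rightarrow> bool" where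
  "order_convergent a l \<longleftrightarrow>
     (\<exists>q. antimono_on {1..} q \<and> is_infimum (q ` {1..}) 0 \<and> (\<forall>n\<ge>1. \<bar>a n - l\<bar> \<le> q n))"

definition p_unit ::
    "('x::archimedean_riesz_space \<Rightarrow> 'e::archimedean_riesz_space) \<Rightarrow> 'x \<Rightarrow> bool" where
  "p_unit p e \<longleftrightarrow> (\<forall>x\<ge>0. order_convergent (\<lambda>n. p (x - inf (real n *\<^sub>R e) x)) 0)"

definition has_natural_density :: "nat set \<Rightarrow> real \<Rightarrow> bool" where
  "has_natural_density K d \<longleftrightarrow> (\<lambda>n. real (card {k \<in> {1..n}. k \<in> K}) / real n) \<longlonglongrightarrow> d"

definition st_decreasing_to_0 :: "(nat \<Rightarrow> 'e::archimedean_riesz_space) \<Rightarrow> bool" where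
  "st_decreasing_to_0 q \<longleftrightarrow>
     (\<exists>K\<subseteq>{1..}. has_natural_density K 1 \<and> antimono_on K q \<and> is_infimum (q ` K) 0)"

definition st_order_convergent :: "(nat \<Rightarrow> 'e::archimedean_riesz_space) \<Rightarrow> 'e \<Rightarrow> bool" where
  "st_order_convergent a l \<longleftrightarrow>
     (\<exists>q K. st_decreasing_to_0 q \<and> K \<subseteq> {1..} \<and> has_natural_density K 1 \<and>
        (\<forall>k\<in>K. \<bar>a k - l\<bar> \<le> q k))"

definition st_up_convergent ::
    "('x::archimedean_riesz_space \<Rightarrow> 'e::archimedean_riesz_space) \<Rightarrow> (nat \<Rightarrow> 'x) \<Rightarrow> 'x \<Rightarrow> bool"
  where
  "st_up_convergent p x l \<longleftrightarrow>
     (\<forall>u\<ge>0. \<exists>q K. st_decreasing_to_0 q \<and> K \<subseteq> {1..} \<and> has_natural_density K 1 \<and>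
        (\<forall>k\<in>K. p (inf \<bar>x k - l\<bar> u) \<le> q k))"

end

theory Submission
  imports Defs
begin

text \<open>
  A \<open>p\<close>-unit \<open>e\<close> is automatically positive: \<open>p (0 - (n e) \<sqinter> 0) = n p (e\<^sup>-)\<close> is bounded.
  For the nontrivial direction, \<open>\<bar>x\<bar> \<sqinter> u \<le> (u - (m e) \<sqinter> u) + m (\<bar>x\<bar> \<sqinter> e)\<close> yields
  \<open>p (\<bar>x\<^sub>k\<bar> \<sqinter> u) \<le> r\<^sub>m + m q\<^sub>k\<close> for every \<open>m\<close>, with \<open>r\<^sub>m \<down> 0\<close>. As \<open>E\<close> need not be Dedekind complete,
  the infimum over all \<open>m\<close> may fail to exist; the finite infima
  \<open>s\<^sub>k = \<Sqinter>{r\<^sub>m + m q\<^sub>k | 1 \<le> m \<le> k}\<close> do exist and still decrease to \<open>0\<close> along a set of density one.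
\<close>

text \<open>By inclusion-exclusion inside \<open>{1..n}\<close>, the counting ratio of
  \<open>A \<inter> B\<close> is at least the sum of the two ratios minus 1. It is at most the ratio
  of \<open>A\<close>, so it is squeezed to 1.\<close>

lemma has_natural_density_1_Int:
  assumes "has_natural_density A 1" "has_natural_density B 1"
  shows "has_natural_density (A \<inter> B) 1"
proof -
  let ?c = "\<lambda>K n. real (card {k \<in> {1..n}. k \<in> K}) / real n"
  have lower: "?c A n + ?c B n - 1 \<le> ?c (A \<inter> B) n" if "n \<ge> 1" for n
  proof -
    let ?A = "{k \<in> {1..n}. k \<in> A}" and ?B = "{k \<in> {1..n}. k \<in> B}"
    have "card ?A + card ?B = card (?A \<union> ?B) + card (?A \<inter> ?B)"
      by (rule card_Un_Int) auto
    moreover have "card (?A \<union> ?B) \<le> card {1..n}"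
      by (intro card_mono) auto
    moreover have "?A \<inter> ?B = {k \<in> {1..n}. k \<in> A \<inter> B}"
      by auto
    ultimately have "card ?A + card ?B \<le> n + card {k \<in> {1..n}. k \<in> A \<inter> B}"
      by simp
    then have "real (card ?A) + real (card ?B) - real n \<le> real (card {k \<in> {1..n}. k \<in> A \<inter> B})"
      by linarith
    from divide_right_mono[OF this, of "real n"] that show ?thesis
      by (simp add: add_divide_distrib diff_divide_distrib)
  qed
  have upper: "?c (A \<inter> B) n \<le> ?c A n" for n
    by (intro divide_right_mono of_nat_mono card_mono) auto
  have "(\<lambda>n. ?c A n + ?c B n - 1) \<longlonglongrightarrow> 1 + 1 - 1"
    using assms unfolding has_natural_density_def by (intro tendsto_intros)
  then have lim: "(\<lambda>n. ?c A n + ?c B n - 1) \<longlonglongrightarrow> 1"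
    by simp
  show ?thesis
    unfolding has_natural_density_def
  proof (rule tendsto_sandwich[OF _ _ lim])
    show "\<forall>\<^sub>F n in sequentially. ?c A n + ?c B n - 1 \<le> ?c (A \<inter> B) n"
      using lower by (intro eventually_sequentiallyI[of 1]) blast
    show "\<forall>\<^sub>F n in sequentially. ?c (A \<inter> B) n \<le> ?c A n"
      using upper by (intro always_eventually allI)
    show "?c A \<longlonglongrightarrow> 1"
      using assms(1) unfolding has_natural_density_def .
  qed
qed

lemma has_natural_density_finite:
  assumes "finite K"
  shows "has_natural_density K 0"
  unfolding has_natural_density_def
proof (rule tendsto_sandwich[OF _ _ tendsto_const])
  show "(\<lambda>n. real (card K) / real n) \<longlonglongrightarrow> 0"
    by (rule lim_const_over_n)
  show "\<forall>\<^sub>F n in sequentially. real (card {k \<in> {1..n}. k \<in> K}) / real n \<le> real (card K) / real n"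
    using assms by (intro always_eventually allI divide_right_mono of_nat_mono card_mono) auto
qed auto

text \<open>A finite set has density 0, so density 1 forces infinitely many elements. This supplies
  arbitrarily late indices when passing to infima along \<open>K\<close>.\<close>

lemma has_natural_density_1_unbounded:
  assumes "has_natural_density K 1"
  obtains k where "k \<in> K" "N \<le> k"
proof -
  have "infinite K"
  proof
    assume "finite K"
    from has_natural_density_finite[OF this] assms show False
      unfolding has_natural_density_def using LIMSEQ_unique by fastforce
  qed
  then show thesis
    using that by (metis finite_nat_set_iff_bounded not_le)
qed

text \<open>Put w = \<open>inf x (a + b)\<close>. Then w - \<open>inf x a\<close> is the supremum of
  w - x and w - a. The first is at most 0; the second is at most x because a is nonnegative, and at
  most b because w is at most a + b. So both lie below \<open>inf x b\<close>.\<close>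

lemma inf_add_le:
  fixes a b x :: "'a::lattice_ab_group_add"
  assumes "0 \<le> x" "0 \<le> a" "0 \<le> b"
  shows "inf x (a + b) \<le> inf x a + inf x b"
proof -
  have "inf x (a + b) - inf x a \<le> inf x b"
  proof -
    have "inf x (a + b) - x \<le> 0"
      by simp
    then have "inf x (a + b) - x \<le> inf x b"
      using assms by (meson le_inf_iff order_trans)
    moreover have "inf x (a + b) - a \<le> x"
      using assms by (simp add: algebra_simps le_infI1 add_increasing)
    moreover have "inf x (a + b) - a \<le> b"
      by (simp add: diff_le_eq add.commute)
    ultimately have "sup (inf x (a + b) - x) (inf x (a + b) - a) \<le> inf x b"
      by simp
    then show ?thesis
      by (simp only: neg_inf_eq_sup add_sup_distrib_left diff_conv_add_uminus)
  qed
  then show ?thesis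
    by (simp only: diff_le_eq add.commute)
qed

lemma inf_scaleR_of_nat_le:
  fixes x e :: "'a::archimedean_riesz_space"
  assumes "0 \<le> x" "0 \<le> e"
  shows "inf x (real m *\<^sub>R e) \<le> real m *\<^sub>R inf x e"
proof (induction m)
  case (Suc m)
  have "inf x (real (Suc m) *\<^sub>R e) = inf x (e + real m *\<^sub>R e)"
    by (simp add: scaleR_left_distrib)
  also have "\<dots> \<le> inf x e + inf x (real m *\<^sub>R e)"
    using assms by (intro inf_add_le) (auto intro: scaleR_nonneg_nonneg)
  also have "\<dots> \<le> inf x e + real m *\<^sub>R inf x e"
    using Suc by (rule add_left_mono)
  finally show ?case
    by (simp add: scaleR_left_distrib)
qed (use assms in auto)

context lattice_normed_riesz_space
begin

lemma p_mono_nonneg: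
  assumes "0 \<le> x" "x \<le> y"
  shows "p x \<le> p y"
  using assms by (intro p_mono) (metis abs_of_nonneg order_trans)

lemma p_unit_nonneg:
  assumes "p_unit p e"
  shows "0 \<le> e"
proof -
  from assms obtain q
    where dec: "antimono_on {1..} q"
      and bound: "\<And>n. n \<ge> 1 \<Longrightarrow> \<bar>p (0 - inf (real n *\<^sub>R e) 0)\<bar> \<le> q n"
    unfolding p_unit_def order_convergent_def by (metis order_refl diff_zero)
  let ?d = "- inf e 0"
  have "real n *\<^sub>R p ?d \<le> q 1" if "n \<ge> 1" for n
  proof -
    have "real n *\<^sub>R inf e 0 \<le> 0"
      by (simp add: scaleR_nonneg_nonpos)
    moreover have "real n *\<^sub>R inf e 0 \<le> real n *\<^sub>R e"
      by (intro scaleR_left_mono) auto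
    \<comment> \<open>Multiplying the left side by 1/n preserves order and gives a lower bound of
      both e and 0.\<close>
    moreover have "inf (real n *\<^sub>R e) 0 \<le> real n *\<^sub>R inf e 0"
    proof -
      have "(1 / real n) *\<^sub>R inf (real n *\<^sub>R e) 0 \<le> (1 / real n) *\<^sub>R (real n *\<^sub>R e)"
        by (intro scaleR_left_mono) auto
      moreover have "(1 / real n) *\<^sub>R inf (real n *\<^sub>R e) 0 \<le> 0"
        by (simp add: scaleR_nonneg_nonpos)
      ultimately have "(1 / real n) *\<^sub>R inf (real n *\<^sub>R e) 0 \<le> inf e 0"
        using that by simp
      from scaleR_left_mono[OF this, of "real n"] that show ?thesis
        by simp
    qed
    ultimately have "inf (real n *\<^sub>R e) 0 = real n *\<^sub>R inf e 0"
      by (intro antisym) auto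
    then have "real n *\<^sub>R p ?d = p (0 - inf (real n *\<^sub>R e) 0)"
      using p_scaleR[of "real n" ?d] by (simp only: scaleR_minus_right diff_0 abs_of_nat)
    also have "\<dots> \<le> q n"
      using bound[OF that] abs_ge_self order_trans by blast
    also have "\<dots> \<le> q 1"
      using dec that by (auto simp: monotone_on_def)
    finally show ?thesis .
  qed
  then have "p ?d \<le> 0"
    by (rule archimedean)
  then have "p ?d = 0"
    using p_nonneg by (intro antisym)
  then have "inf e 0 = 0"
    by (simp only: p_eq_0_iff neg_equal_0_iff_equal)
  then show ?thesis
    by (simp add: inf.absorb_iff2 inf.commute)
qed

lemma p_inf_le:
  assumes "0 \<le> x" "0 \<le> u" "0 \<le> e"
  shows "p (inf x u) \<le> p (u - inf (real m *\<^sub>R e) u) + real m *\<^sub>R p (inf x e)"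
proof -
  let ?w = "inf (real m *\<^sub>R e) u"
  have me: "0 \<le> real m *\<^sub>R e"
    using assms by (simp add: scaleR_nonneg_nonneg)
  \<comment> \<open>Split u into the part \<open>?w\<close> lying below m e and the remainder.
    Subadditivity of \<open>inf\<close> treats them separately: the remainder is what the
    \<open>p\<close>-unit property makes small, and \<open>?w\<close> is controlled by
    \<open>inf x e\<close>.\<close>
  have "inf x u = inf x ((u - ?w) + ?w)"
    by (simp only: diff_add_cancel)
  also have "\<dots> \<le> inf x (u - ?w) + inf x ?w"
    using assms me by (intro inf_add_le) (simp_all only: diff_ge_0_iff_ge inf.cobounded2 le_inf_iff)
  also have "\<dots> \<le> (u - ?w) + inf x (real m *\<^sub>R e)"
    by (intro add_mono inf_mono order_refl) auto
  also have "\<dots> \<le> (u - ?w) + real m *\<^sub>R inf x e"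
    using assms by (intro add_left_mono inf_scaleR_of_nat_le)
  finally have "p (inf x u) \<le> p ((u - ?w) + real m *\<^sub>R inf x e)"
    using assms by (intro p_mono_nonneg) auto
  also have "\<dots> \<le> p (u - ?w) + p (real m *\<^sub>R inf x e)"
    by (rule p_triangle)
  finally show ?thesis
    by (simp add: p_scaleR)
qed

end

text \<open>As k increases in \<open>K\<close>, \<open>q k\<close> falls and more terms enter the
  finite infimum, so \<open>s\<close> decreases. For a fixed m, a lower bound b of \<open>s\<close>
  on \<open>K\<close> satisfies b \<le> r m + m q k for all late k in \<open>K\<close>. Exhausting k
  gives b \<le> r m, and then varying m gives b \<le> 0.\<close>

lemma st_decreasing_to_0_Inf_fin:
  fixes q r :: "nat \<Rightarrow> 'e::archimedean_riesz_space"
  assumes q: "antimono_on J q" "is_infimum (q ` J) 0"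
    and r: "is_infimum (r ` {1..}) 0"
    and K: "K \<subseteq> J" "K \<subseteq> {1..}" "has_natural_density K 1"
  defines "s \<equiv> \<lambda>k. Inf_fin ((\<lambda>m. r m + real m *\<^sub>R q k) ` {1..k})"
  shows "st_decreasing_to_0 s"
proof -
  have q_nonneg: "0 \<le> q k" if "k \<in> K" for k
    using that q(2) K(1) by (auto simp: is_infimum_def)
  have r_nonneg: "0 \<le> r m" if "m \<ge> 1" for m
    using that r by (auto simp: is_infimum_def)
  have s_le: "s k \<le> r m + real m *\<^sub>R q k" if "1 \<le> m" "m \<le> k" for m k
    unfolding s_def using that by (intro Inf_fin.coboundedI) auto
  \<comment> \<open>At k = 0 the infimum would range over the empty set and be unspecified, hence
    the condition on k.\<close>
  have le_s: "b \<le> s k"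
    if "k \<ge> 1" "\<And>m. 1 \<le> m \<Longrightarrow> m \<le> k \<Longrightarrow> b \<le> r m + real m *\<^sub>R q k" for b k
    unfolding s_def using that by (intro Inf_fin.boundedI) auto
  have "antimono_on K s"
  proof (rule monotone_onI)
    fix j k assume jk: "j \<in> K" "k \<in> K" "j \<le> k"
    then have "q k \<le> q j"
      using q(1) K(1) by (auto simp: monotone_on_def)
    then have "s k \<le> r m + real m *\<^sub>R q j" if "1 \<le> m" "m \<le> j" for m
      using that jk s_le[of m k]
      by (meson add_left_mono of_nat_0_le_iff order_trans scaleR_left_mono)
    then show "s k \<le> s j"
      using jk K(2) by (intro le_s) auto
  qed
  moreover have "is_infimum (s ` K) 0"
    unfolding is_infimum_def
  proof (intro conjI allI impI ballI)
    fix y assume "y \<in> s ` K"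
    then obtain k where k: "k \<in> K" "y = s k"
      by blast
    then show "0 \<le> y"
      using K(2) q_nonneg r_nonneg
      by (auto intro!: le_s add_nonneg_nonneg scaleR_nonneg_nonneg)
  next
    fix b assume b: "\<forall>y\<in>s ` K. b \<le> y"
    have "b \<le> r m" if m: "m \<ge> 1" for m
    proof -
      \<comment> \<open>The infimum of \<open>q\<close> is taken over \<open>J\<close>, but the
        estimate is available only at k in \<open>K\<close> with k \<ge> m. Choosing such a k beyond
        j as well, monotonicity of \<open>q\<close> on \<open>J\<close> carries the bound back to
        j.\<close>
      have "(1 / real m) *\<^sub>R (b - r m) \<le> q j" if j: "j \<in> J" for j
      proof -
        obtain k where k: "k \<in> K" "max j m \<le> k"
          using has_natural_density_1_unbounded[OF K(3)] .
        have "b \<le> r m + real m *\<^sub>R q k"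
          using b k m s_le[of m k] order_trans by fastforce
        then have "b - r m \<le> real m *\<^sub>R q k"
          by (simp add: diff_le_eq add.commute)
        from scaleR_left_mono[OF this, of "1 / real m"] m
        have "(1 / real m) *\<^sub>R (b - r m) \<le> q k"
          by simp
        also have "q k \<le> q j"
          using q(1) k K(1) j by (auto simp: monotone_on_def)
        finally show ?thesis .
      qed
      then have "(1 / real m) *\<^sub>R (b - r m) \<le> 0"
        using q(2) by (auto simp: is_infimum_def)
      from scaleR_left_mono[OF this, of "real m"] m show ?thesis
        by simp
    qed
    then show "b \<le> 0"
      using r by (auto simp: is_infimum_def)
  qed
  ultimately show ?thesis
    unfolding st_decreasing_to_0_def using K by blast
qed

theorem theorem4p3:
  fixes p :: "'x::archimedean_riesz_space \<Rightarrow> 'e::archimedean_riesz_space"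
    and e :: 'x
    and x :: "nat \<Rightarrow> 'x"
  assumes "lattice_normed_riesz_space p"
    and "p_unit p e"
  shows "st_up_convergent p x 0 \<longleftrightarrow> st_order_convergent (\<lambda>n. p (inf \<bar>x n\<bar> e)) 0"
proof
  interpret lattice_normed_riesz_space p
    by fact
  have e: "0 \<le> e"
    using assms(2) by (rule p_unit_nonneg)
  have abs_p: "\<bar>p y - 0\<bar> = p y" for y
    using p_nonneg by simp
  \<comment> \<open>Take u = e, which is admissible because e is nonnegative.\<close>
  show "st_order_convergent (\<lambda>n. p (inf \<bar>x n\<bar> e)) 0" if "st_up_convergent p x 0"
    using that e unfolding st_up_convergent_def st_order_convergent_def abs_p by simp
  assume "st_order_convergent (\<lambda>n. p (inf \<bar>x n\<bar> e)) 0"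
  then obtain q J K
    where J: "J \<subseteq> {1..}" "has_natural_density J 1" "antimono_on J q" "is_infimum (q ` J) 0"
      and K: "K \<subseteq> {1..}" "has_natural_density K 1"
      and le_q: "\<And>k. k \<in> K \<Longrightarrow> p (inf \<bar>x k\<bar> e) \<le> q k"
    unfolding st_order_convergent_def st_decreasing_to_0_def abs_p by blast
  \<comment> \<open>\<open>q\<close> decreases along \<open>J\<close> while it dominates the norms
    along \<open>K\<close>; the argument needs indices where both hold.\<close>
  have dense: "has_natural_density (J \<inter> K) 1"
    using J(2) K(2) by (rule has_natural_density_1_Int)
  show "st_up_convergent p x 0"
    unfolding st_up_convergent_def
  proof (intro allI impI)
    fix u :: 'x assume u: "0 \<le> u"
    \<comment> \<open>\<open>r\<close> depends on u, as the definition of st-up-convergence permits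
      for the dominating sequence.\<close>
    obtain r where r: "is_infimum (r ` {1..}) 0"
      and le_r: "\<And>m. m \<ge> 1 \<Longrightarrow> p (u - inf (real m *\<^sub>R e) u) \<le> r m"
      using assms(2) u unfolding p_unit_def order_convergent_def abs_p by blast
    define s where "s = (\<lambda>k. Inf_fin ((\<lambda>m. r m + real m *\<^sub>R q k) ` {1..k}))"
    have "st_decreasing_to_0 s"
      unfolding s_def using J K dense r by (intro st_decreasing_to_0_Inf_fin[of J]) auto
    moreover have "p (inf \<bar>x k - 0\<bar> u) \<le> s k" if k: "k \<in> J \<inter> K" for k
      unfolding s_def
    proof (rule Inf_fin.boundedI)
      show "(\<lambda>m. r m + real m *\<^sub>R q k) ` {1..k} \<noteq> {}"
        using k K(1) by auto
      fix y assume "y \<in> (\<lambda>m. r m + real m *\<^sub>R q k) ` {1..k}"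
      then obtain m where m: "1 \<le> m" "y = r m + real m *\<^sub>R q k"
        by auto
      have "p (inf \<bar>x k\<bar> u) \<le> p (u - inf (real m *\<^sub>R e) u) + real m *\<^sub>R p (inf \<bar>x k\<bar> e)"
        using u e by (intro p_inf_le) auto
      also have "\<dots> \<le> y"
        unfolding m(2) using le_q k le_r m(1) by (intro add_mono scaleR_left_mono) auto
      finally show "p (inf \<bar>x k - 0\<bar> u) \<le> y"
        by simp
    qed simp
    ultimately show "\<exists>q K. st_decreasing_to_0 q \<and> K \<subseteq> {1..} \<and> has_natural_density K 1 \<and>
        (\<forall>k\<in>K. p (inf \<bar>x k - 0\<bar> u) \<le> q k)"
      using J(1) dense by blast
  qed
qed

end
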